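(* Let $\mathcal{F}_n=\{E_1|H_1,\ldots,E_n|H_n\}$ be a p-consistent family of $n$ conditional events and $E|H$ a conditional event. The following assertions are equivalent: a) the family $\mathcal{F}_n\cup\{E|H\}$ is p-consistent; b) exactly one of the following alternatives holds: (i) $\mathcal{F}_n$ p-entails $E|H$; (ii) the assessment $\mathcal{P}=(1,\ldots,1,z)$ on $\mathcal{F}_n\cup\{E|H\}$, where $P(E_i|H_i)=1$ for $i=1,\ldots,n$ and $P(E|H)=z$, is coherent for every $z\in[0,1]$.
   Context: Events are elements of a Boolean algebra with sure event $\Omega$ and impossible event $\emptyset$; $AB$ is conjunction, $A\vee B$ disjunction, $A^c$ negation, $A\subseteq B$ logical implication; an event is identified with its indicator. A conditional event $E|H$ is given by events $E,H$ with $H\neq\emptyset$; it is true if $EH$ is true, false if $E^cH$ is true, void if $H^c$ is true. $A|H=B|K$ means $AH=BK$ and $H=K$. Coherence. An assessment $(p_1,\ldots,p_n)$ of real numbers, with $p_i=P(E_i|H_i)$, on a finite list of conditional events $E_1|H_1,\ldots,E_n|H_n$ is coherent if for every nonempty $J\subseteq\{1,\ldots,n\}$ and all real numbers $s_j$ ($j\in J$), the random gain $\mathcal{G}=\sum_{j\in J}s_jH_j(E_j-p_j)$, restricted to $\bigvee_{j\in J}H_j$ (i.e. considering its finitely many values on the possible outcomes implying $\bigvee_{j\in J}H_j$), satisfies $\min\mathcal{G}\le 0\le\max\mathcal{G}$. Assessments on $\mathcal{F}_n\cup\{E|H\}$ are understood on the list of $n+1$ conditional events $E_1|H_1,\ldots,E_n|H_n,E|H$,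 even if $E|H=E_i|H_i$ for some $i$. p-consistency. A family $\{E_i|H_i: i=1,\ldots,n\}$ is p-consistent if for every $(\alpha_1,\ldots,\alpha_n)\in[0,1)^n$ there is a coherent assessment $(p_1,\ldots,p_n)$ on it with $p_i\ge\alpha_i$ for all $i$. p-entailment. A p-consistent family $\{E_i|H_i: i=1,\ldots,n\}$ p-entails $B|A$ if there is a nonempty $J\subseteq\{1,\ldots,n\}$ such that for every $\alpha\in[0,1)$ there exist $\alpha_i\in[0,1)$, $i\in J$, such that for all coherent assessments $(z,p_i, i\in J)$ on $\{B|A,\ E_i|H_i,\ i\in J\}$, with $z=P(B|A)$, $p_i=P(E_i|H_i)$: if $p_i\ge\alpha_i$ for every $i\in J$, then $z\ge\alpha$. *)

theory Defs
  imports Complex_Main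
begin

text \<open>
  Events are elements of a Boolean algebra. A finite list of conditional events
  \<open>E i | H i\<close> is given by two indexed families \<open>E\<close> and \<open>H\<close> and a finite set of indices;
  indexing keeps repeated conditional events apart. The requirement that each \<open>H i\<close> differs
  from \<open>\<bottom>\<close> is not part of the definitions below and has to be assumed where they are used.
\<close>

text \<open>
  The possible outcomes relative to a finite nonempty set of events \<open>X\<close>: the nonzero
  conjunctions containing each event of \<open>X\<close> or its negation. An event \<open>A \<in> X\<close> is true at the
  outcome \<open>c\<close> if \<open>c \<le> A\<close> and false otherwise, so its indicator at \<open>c\<close> is \<open>of_bool (c \<le> A)\<close>.
\<close>

definition constituents :: "'a::boolean_algebra set \<Rightarrow> 'a set" where
  "constituents X =
     {c. c \<noteq> bot \<and> (\<exists>S\<subseteq>X. c = Inf_fin ((\<lambda>A. if A \<in> S then A else - A) ` X))}"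

definition gain ::
  "'i set \<Rightarrow> ('i \<Rightarrow> 'a::boolean_algebra) \<Rightarrow> ('i \<Rightarrow> 'a) \<Rightarrow> ('i \<Rightarrow> real) \<Rightarrow> ('i \<Rightarrow> real) \<Rightarrow> 'a \<Rightarrow> real" where
  "gain J E H p s c = (\<Sum>j\<in>J. s j * of_bool (c \<le> H j) * (of_bool (c \<le> E j) - p j))"

definition gain_values ::
  "'i set \<Rightarrow> ('i \<Rightarrow> 'a::boolean_algebra) \<Rightarrow> ('i \<Rightarrow> 'a) \<Rightarrow> ('i \<Rightarrow> real) \<Rightarrow> ('i \<Rightarrow> real) \<Rightarrow> real set" where
  "gain_values J E H p s =
     gain J E H p s ` {c \<in> constituents (E ` J \<union> H ` J). c \<le> Sup_fin (H ` J)}"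

definition coherent ::
  "'i set \<Rightarrow> ('i \<Rightarrow> 'a::boolean_algebra) \<Rightarrow> ('i \<Rightarrow> 'a) \<Rightarrow> ('i \<Rightarrow> real) \<Rightarrow> bool" where
  "coherent I E H p \<longleftrightarrow>
     (\<forall>J s. J \<subseteq> I \<and> J \<noteq> {} \<longrightarrow>
        Min (gain_values J E H p s) \<le> 0 \<and> 0 \<le> Max (gain_values J E H p s))"

definition p_consistent ::
  "'i set \<Rightarrow> ('i \<Rightarrow> 'a::boolean_algebra) \<Rightarrow> ('i \<Rightarrow> 'a) \<Rightarrow> bool" where
  "p_consistent I E H \<longleftrightarrow>
     (\<forall>\<alpha>. (\<forall>i\<in>I. \<alpha> i \<in> {0..<1}) \<longrightarrow> (\<exists>p. coherent I E H p \<and> (\<forall>i\<in>I. \<alpha> i \<le> p i)))"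

text \<open>
  The family \<open>E 1 | H 1, \<dots>, E n | H n\<close> p-entails \<open>B | A\<close>, where \<open>B | A\<close> is put at the unused
  index \<open>Suc n\<close>. The notion is meant for p-consistent families only.
\<close>

definition p_entails ::
  "nat \<Rightarrow> (nat \<Rightarrow> 'a::boolean_algebra) \<Rightarrow> (nat \<Rightarrow> 'a) \<Rightarrow> 'a \<Rightarrow> 'a \<Rightarrow> bool" where
  "p_entails n E H B A \<longleftrightarrow>
     (\<exists>J. J \<subseteq> {1..n} \<and> J \<noteq> {} \<and>
       (\<forall>\<alpha>::real. \<alpha> \<in> {0..<1} \<longrightarrow>
         (\<exists>a::nat \<Rightarrow> real. (\<forall>i\<in>J. a i \<in> {0..<1}) \<and>
           (\<forall>p z. coherent (insert (Suc n) J) (E(Suc n := B)) (H(Suc n := A)) (p(Suc n := z)) \<longrightarrow>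
                  (\<forall>i\<in>J. a i \<le> p i) \<longrightarrow> \<alpha> \<le> z))))"

text \<open>The minimum and maximum in the definition of coherence are taken over a finite nonempty set.\<close>

lemma finite_constituents: "finite X \<Longrightarrow> finite (constituents X)"
  by (rule finite_subset[of _ "(\<lambda>S. Inf_fin ((\<lambda>A. if A \<in> S then A else - A) ` X)) ` Pow X"])
     (auto simp: constituents_def)

lemma constituent_meeting:
  fixes x :: "'a::boolean_algebra"
  assumes "finite X" "X \<noteq> {}" "x \<noteq> bot"
  shows "\<exists>c\<in>constituents X. inf c x \<noteq> bot"
proof -
  have split: "x = sup (inf A x) (inf (- A) x)" for A x :: 'a
    by (simp flip: inf_sup_distrib2)
  have "\<exists>S\<subseteq>X. inf (Inf_fin ((\<lambda>A. if A \<in> S then A else - A) ` X)) x \<noteq> bot"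
    using assms
  proof (induction X arbitrary: x rule: finite_ne_induct)
    case (singleton A)
    have "inf A x \<noteq> bot \<or> inf (- A) x \<noteq> bot"
      using split[of x A] singleton by auto
    then show ?case
    proof
      assume "inf A x \<noteq> bot"
      then show ?thesis by (intro exI[of _ "{A}"]) simp
    next
      assume "inf (- A) x \<noteq> bot"
      then show ?thesis by (intro exI[of _ "{}"]) simp
    qed
  next
    case (insert A F)
    have step: ?case if "inf l x \<noteq> bot" "l = (if b then A else - A)" for l b
    proof -
      from insert.IH[OF that(1)] obtain S where
        S: "S \<subseteq> F" "inf (Inf_fin ((\<lambda>A. if A \<in> S then A else - A) ` F)) (inf l x) \<noteq> bot" by blast
      define T where "T = (if b then insert A S else S)"
      have "(\<lambda>A. if A \<in> T then A else - A) ` F = (\<lambda>A. if A \<in> S then A else - A) ` F"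
        using insert.hyps by (intro image_cong) (auto simp: T_def)
      moreover have "(if A \<in> T then A else - A) = l"
        using S(1) insert.hyps that(2) by (auto simp: T_def)
      ultimately have "Inf_fin ((\<lambda>A. if A \<in> T then A else - A) ` insert A F)
          = inf l (Inf_fin ((\<lambda>A. if A \<in> S then A else - A) ` F))"
        using insert.hyps
        by (simp only: image_insert Inf_fin.insert finite_imageI image_is_empty not_False_eq_True)
      then have "inf (Inf_fin ((\<lambda>A. if A \<in> T then A else - A) ` insert A F)) x
          = inf (Inf_fin ((\<lambda>A. if A \<in> S then A else - A) ` F)) (inf l x)"
        by (simp only: ac_simps)
      with S(2) have "inf (Inf_fin ((\<lambda>A. if A \<in> T then A else - A) ` insert A F)) x \<noteq> bot"
        by (simp only: not_False_eq_True)
      moreover have "T \<subseteq> insert A F" using S(1) by (auto simp: T_def)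
      ultimately show ?thesis by blast
    qed
    have "inf A x \<noteq> bot \<or> inf (- A) x \<noteq> bot"
      using split[of x A] insert.prems by auto
    then show ?case using step[of A True] step[of "- A" False] by auto
  qed
  then obtain S where S: "S \<subseteq> X" "inf (Inf_fin ((\<lambda>A. if A \<in> S then A else - A) ` X)) x \<noteq> bot"
    by blast
  then have "Inf_fin ((\<lambda>A. if A \<in> S then A else - A) ` X) \<in> constituents X"
    unfolding constituents_def using inf_bot_left[of x] by (intro CollectI conjI exI[of _ S] notI) (simp_all only: simp_thms)
  with S(2) show ?thesis by blast
qed

lemma finite_gain_values: "finite J \<Longrightarrow> finite (gain_values J E H p s)"
  by (simp add: gain_values_def finite_constituents)

lemma gain_values_nonempty:
  assumes "finite J" "j \<in> J" "H j \<noteq> bot"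
  shows "gain_values J E H p s \<noteq> {}"
proof -
  let ?X = "E ` J \<union> H ` J"
  have X: "finite ?X" "H j \<in> ?X" using assms by auto
  obtain c where c: "c \<in> constituents ?X" "inf c (H j) \<noteq> bot"
    using constituent_meeting[of ?X "H j"] X assms by blast
  from c(1) obtain S where S: "c = Inf_fin ((\<lambda>A. if A \<in> S then A else - A) ` ?X)"
    unfolding constituents_def by blast
  have "c \<le> (if H j \<in> S then H j else - H j)"
    unfolding S using X by (intro Inf_fin.coboundedI) auto
  with c(2) have "c \<le> H j" by (auto split: if_splits simp: inf_shunt)
  also have "H j \<le> Sup_fin (H ` J)" using assms by (intro Sup_fin.coboundedI) auto
  finally show ?thesis using c(1) by (auto simp: gain_values_def)
qed

end

theory Submission
  imports Defs
begin

text \<open>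
  Everything depends on the two extreme values of \<open>z\<close>. Let \<open>C z\<close> say that the assessment
  \<open>(1, \<dots>, 1, z)\<close> is coherent. Then the theorem is propositional logic applied to four facts.

  \<^item> The enlarged family is p-consistent iff \<open>C 1\<close> (\<open>p_consistent_iff\<close>).
  \<^item> The family p-entails \<open>E | H\<close> iff \<open>C 0\<close> fails (\<open>p_entails_iff\<close>).
  \<^item> \<open>C 0\<close> and \<open>C 1\<close> together give \<open>C z\<close> for all \<open>z\<close> in the unit interval
    (\<open>coherent_between\<close>), because a gain is monotone in each single probability.
  \<^item> As the given family is p-consistent, \<open>C 0\<close> or \<open>C 1\<close> holds (\<open>coherent_one_extends\<close>).

  What makes these accessible is that the coherence of an assessment consisting of ones is a
  combinatorial property: every nonempty subfamily \<open>J\<close> is verifiable, i.e. some outcome makes a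
  member of \<open>J\<close> true and no member false (\<open>coherent_one_iff\<close>). At such an outcome every bet at
  price 1 has gain 0; if there is none, then buying every member of \<open>J\<close> at a price near 1 is a sure
  loss. Quantitatively, the uncertainties \<open>1 - p j\<close> over a subfamily that is not verifiable sum
  up to at least 1 (\<open>verifiable_if_sum_less_1\<close>). This inequality, applied after the replacement
  of \<open>E | H\<close> by its negation \<open>- E | H\<close>, whose probability is \<open>1 - z\<close>, is also the reason why
  the failure of \<open>C 0\<close> forces \<open>z\<close> to be large whenever all \<open>p i\<close> are.
\<close>

section \<open>Coherence through deciding events\<close>

lemma constituent_decides:
  assumes "finite X" "A \<in> X" "c \<in> constituents X"
  shows "c \<le> A \<or> c \<le> - A"
proof -
  from assms(3) obtain S where S: "c = Inf_fin ((\<lambda>A. if A \<in> S then A else - A) ` X)"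
    unfolding constituents_def by blast
  have "c \<le> (if A \<in> S then A else - A)"
    unfolding S using assms by (intro Inf_fin.coboundedI) auto
  then show ?thesis by (auto split: if_splits)
qed

lemma le_uminus_iff_not_le:
  fixes x A :: "'a::boolean_algebra"
  assumes "x \<noteq> bot" "x \<le> A \<or> x \<le> - A"
  shows "x \<le> - A \<longleftrightarrow> \<not> x \<le> A"
proof -
  have "x = bot" if "x \<le> A" "x \<le> - A"
    using le_infI[OF that] by (simp add: bot_unique)
  then show ?thesis using assms by blast
qed

text \<open>
  Constituents depend on the exact set of events that generates them, so they may change when one
  event is negated or when a subfamily is taken. Gains see only which events an outcome decides,
  and how, and therefore any nonzero event that decides all of them can serve as an outcome.
\<close>

definition decides :: "'i set \<Rightarrow> ('i \<Rightarrow> 'a::boolean_algebra) \<Rightarrow> ('i \<Rightarrow> 'a) \<Rightarrow> 'a \<Rightarrow> bool" where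
  "decides J E H x \<longleftrightarrow>
     x \<noteq> bot \<and> (\<forall>j\<in>J. (x \<le> E j \<or> x \<le> - E j) \<and> (x \<le> H j \<or> x \<le> - H j))"

lemma decides_constituent:
  assumes "finite J" "c \<in> constituents (E ` J \<union> H ` J)"
  shows "decides J E H c"
  using assms constituent_decides[of "E ` J \<union> H ` J"]
  by (auto simp: decides_def constituents_def)

lemma decides_below:
  assumes "finite J" "x \<noteq> bot"
  obtains y where "y \<le> x" "decides J E H y"
proof (cases "J = {}")
  case True
  then show ?thesis using that[of x] assms by (simp add: decides_def)
next
  case False
  then obtain c where c: "c \<in> constituents (E ` J \<union> H ` J)" "inf c x \<noteq> bot"
    using constituent_meeting[of "E ` J \<union> H ` J" x] assms by auto
  have "decides J E H (inf c x)"
    using decides_constituent[OF assms(1) c(1)] c(2) by (auto simp: decides_def intro: le_infI1)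
  then show ?thesis using that[of "inf c x"] by simp
qed

lemma deciding_le_Sup_fin:
  assumes "finite J" "J \<noteq> {}" "decides J E H x" "x \<le> Sup_fin (H ` J)"
  shows "\<exists>j\<in>J. x \<le> H j"
proof (rule ccontr)
  assume "\<not> ?thesis"
  then have "\<forall>j\<in>J. x \<le> - H j" using assms(3) by (auto simp: decides_def)
  then have "\<forall>j\<in>J. H j \<le> - x" using compl_le_swap1 by blast
  then have "Sup_fin (H ` J) \<le> - x" using assms by (intro Sup_fin.boundedI) auto
  with assms(4) have "x \<le> - x" by (rule order_trans)
  then have "x \<le> inf x (- x)" using le_infI[of x x "- x"] by simp
  then show False using assms(3) by (auto simp: decides_def bot_unique)
qed

text \<open>
  The lower bound on the maximal gain suffices, since replacing the stakes \<open>s\<close> by \<open>- s\<close> turns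
  it into the upper bound on the minimal gain.
\<close>

lemma coherent_iff:
  assumes fin: "finite I" and H: "\<forall>i\<in>I. H i \<noteq> bot"
  shows "coherent I E H p \<longleftrightarrow>
    (\<forall>J s. J \<subseteq> I \<and> J \<noteq> {} \<longrightarrow>
       (\<exists>x. decides J E H x \<and> (\<exists>j\<in>J. x \<le> H j) \<and> 0 \<le> gain J E H p s x))"
    (is "_ \<longleftrightarrow> ?R")
proof
  assume coh: "coherent I E H p"
  show ?R
  proof (intro allI impI)
    fix J s assume J: "J \<subseteq> I \<and> J \<noteq> {}"
    then have finJ: "finite J" using fin finite_subset by blast
    from J obtain j where "j \<in> J" "H j \<noteq> bot" using H by blast
    then have "Max (gain_values J E H p s) \<in> gain_values J E H p s"
      using finJ by (intro Max_in finite_gain_values gain_values_nonempty)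
    moreover have "0 \<le> Max (gain_values J E H p s)"
      using coh J by (auto simp: coherent_def)
    ultimately obtain c where "c \<in> constituents (E ` J \<union> H ` J)" "c \<le> Sup_fin (H ` J)"
      "0 \<le> gain J E H p s c"
      by (auto simp: gain_values_def)
    then show "\<exists>x. decides J E H x \<and> (\<exists>j\<in>J. x \<le> H j) \<and> 0 \<le> gain J E H p s x"
      using decides_constituent[OF finJ, of c E H] deciding_le_Sup_fin[OF finJ, of E H c] J by blast
  qed
next
  assume R: ?R
  have attained: "\<exists>x. gain J E H p t x \<in> gain_values J E H p t \<and> 0 \<le> gain J E H p s x"
    if J: "J \<subseteq> I" "J \<noteq> {}" for J s t
  proof -
    have finJ: "finite J" using fin J finite_subset by blast
    from R J obtain x j where x: "decides J E H x" "j \<in> J" "x \<le> H j" "0 \<le> gain J E H p s x"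
      by blast
    obtain c where c: "c \<in> constituents (E ` J \<union> H ` J)" "inf c x \<noteq> bot"
      using constituent_meeting[of "E ` J \<union> H ` J" x] finJ J x(1) by (auto simp: decides_def)
    have c_dec: "decides J E H c" using decides_constituent[OF finJ c(1)] .
    \<comment> \<open>Two deciding events that meet agree on every event that they decide.\<close>
    have agree: "c \<le> A \<longleftrightarrow> x \<le> A" if "c \<le> A \<or> c \<le> - A" "x \<le> A \<or> x \<le> - A" for A
      using that le_uminus_iff_not_le[OF c(2), of A] le_infI1[of c _ x] le_infI2[of x _ c] by blast
    have "gain J E H p s c = gain J E H p s x"
      unfolding gain_def using agree c_dec x(1) by (intro sum.cong) (auto simp: decides_def)
    moreover have "c \<le> Sup_fin (H ` J)"
    proof -
      have "c \<le> H j" using agree[of "H j"] c_dec x by (auto simp: decides_def)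
      also have "H j \<le> Sup_fin (H ` J)" using x finJ by (intro Sup_fin.coboundedI) auto
      finally show ?thesis .
    qed
    ultimately show ?thesis using c(1) x(4) by (auto simp: gain_values_def intro!: exI[of _ c])
  qed
  show "coherent I E H p"
    unfolding coherent_def
  proof (intro allI impI)
    fix J s assume J: "J \<subseteq> I \<and> J \<noteq> {}"
    have fing: "finite (gain_values J E H p s)"
      using J fin by (intro finite_gain_values) (auto intro: finite_subset)
    obtain x where x: "gain J E H p s x \<in> gain_values J E H p s" "0 \<le> gain J E H p s x"
      using attained J by blast
    obtain y where y: "gain J E H p s y \<in> gain_values J E H p s" "0 \<le> gain J E H p (\<lambda>j. - s j) y"
      using attained J by blast
    have "gain J E H p (\<lambda>j. - s j) y = - gain J E H p s y"
      by (simp add: gain_def sum_negf)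
    then have "Min (gain_values J E H p s) \<le> 0"
      using Min_le[OF fing y(1)] y(2) by linarith
    moreover have "0 \<le> Max (gain_values J E H p s)"
      using Max_ge[OF fing x(1)] x(2) by linarith
    ultimately show "Min (gain_values J E H p s) \<le> 0 \<and> 0 \<le> Max (gain_values J E H p s)" ..
  qed
qed

lemma coherent_subset: "coherent I E H p \<Longrightarrow> I' \<subseteq> I \<Longrightarrow> coherent I' E H p"
  unfolding coherent_def by blast

lemma coherent_cong:
  assumes "\<And>i. i \<in> I \<Longrightarrow> E i = E' i" "\<And>i. i \<in> I \<Longrightarrow> H i = H' i" "\<And>i. i \<in> I \<Longrightarrow> p i = p' i"
  shows "coherent I E H p \<longleftrightarrow> coherent I E' H' p'"
proof -
  have "gain_values J E H p s = gain_values J E' H' p' s" if "J \<subseteq> I" for J s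
  proof -
    have J: "E j = E' j" "H j = H' j" "p j = p' j" if "j \<in> J" for j
      using that \<open>J \<subseteq> I\<close> assms by auto
    then have "gain J E H p s = gain J E' H' p' s"
      by (auto simp: gain_def intro!: sum.cong)
    moreover have "E ` J = E' ` J" "H ` J = H' ` J"
      using J by (auto intro!: image_cong)
    ultimately show ?thesis by (simp only: gain_values_def)
  qed
  then show ?thesis unfolding coherent_def by (metis (no_types, lifting))
qed

lemma coherent_le_1:
  assumes "finite I" "\<forall>i\<in>I. H i \<noteq> bot" "coherent I E H p" "i \<in> I"
  shows "p i \<le> 1"
proof -
  from assms have "\<exists>x. decides {i} E H x \<and> (\<exists>j\<in>{i}. x \<le> H j) \<and> 0 \<le> gain {i} E H p (\<lambda>_. 1) x"
    using coherent_iff[of I H E p] by (metis bot.extremum empty_not_insert insert_subset)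
  then show ?thesis by (auto simp: gain_def of_bool_def split: if_splits)
qed

text \<open>
  Betting on \<open>- E k | H k\<close> at price \<open>1 - p k\<close> is betting on \<open>E k | H k\<close> at price \<open>p k\<close> with the
  opposite stake.
\<close>

lemma coherent_negate:
  assumes fin: "finite I" and H: "\<forall>i\<in>I. H i \<noteq> bot" and coh: "coherent I E H p"
  shows "coherent I (E(k := - E k)) H (p(k := 1 - p k))"
  unfolding coherent_iff[of I H, OF fin H]
proof (intro allI impI)
  fix J s assume J: "J \<subseteq> I \<and> J \<noteq> {}"
  then obtain x where x: "decides J E H x" "\<exists>j\<in>J. x \<le> H j"
    "0 \<le> gain J E H p (s(k := - s k)) x"
    using coh coherent_iff[of I H E p, OF fin H] by meson
  have "gain J E H p (s(k := - s k)) x = gain J (E(k := - E k)) H (p(k := 1 - p k)) s x"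
    unfolding gain_def
  proof (rule sum.cong)
    fix j assume "j \<in> J"
    then have "x \<le> - E j \<longleftrightarrow> \<not> x \<le> E j"
      using le_uminus_iff_not_le[of x "E j"] x(1) by (auto simp: decides_def)
    then show "(s(k := - s k)) j * of_bool (x \<le> H j) * (of_bool (x \<le> E j) - p j) =
      s j * of_bool (x \<le> H j) * (of_bool (x \<le> (E(k := - E k)) j) - (p(k := 1 - p k)) j)"
      by (cases "j = k") (auto simp: algebra_simps)
  qed simp
  moreover have "decides J (E(k := - E k)) H x"
    using x(1) by (auto simp: decides_def)
  ultimately show "\<exists>x. decides J (E(k := - E k)) H x \<and> (\<exists>j\<in>J. x \<le> H j) \<and>
      0 \<le> gain J (E(k := - E k)) H (p(k := 1 - p k)) s x"
    using x by auto
qed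

text \<open>
  At a fixed outcome the gain is monotone in the price \<open>z\<close> of \<open>E k | H k\<close>, with a direction given
  by the sign of the stake \<open>s k\<close> alone. An outcome without loss at the endpoint which is worse for
  the bettor is thus an outcome without loss at \<open>z\<close>.
\<close>

lemma coherent_between:
  assumes fin: "finite I" and H: "\<forall>i\<in>I. H i \<noteq> bot"
    and a: "coherent I E H (p(k := a))" and b: "coherent I E H (p(k := b))"
    and z: "a \<le> z" "z \<le> b"
  shows "coherent I E H (p(k := z))"
  unfolding coherent_iff[of I H, OF fin H]
proof (intro allI impI)
  fix J and s :: "'a \<Rightarrow> real" assume J: "J \<subseteq> I \<and> J \<noteq> {}"
  define e where "e = (if s k \<ge> 0 then b else a)"
  have "coherent I E H (p(k := e))" using a b by (simp add: e_def)
  then obtain x where x: "decides J E H x" "\<exists>j\<in>J. x \<le> H j" "0 \<le> gain J E H (p(k := e)) s x"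
    using J coherent_iff[of I H E "p(k := e)", OF fin H] by meson
  have "gain J E H (p(k := e)) s x \<le> gain J E H (p(k := z)) s x"
    unfolding gain_def
  proof (rule sum_mono)
    fix j
    have "s k * (c - e) \<le> s k * (c - z)" for c
      using z by (auto simp: e_def intro: mult_left_mono mult_left_mono_neg)
    then show "s j * of_bool (x \<le> H j) * (of_bool (x \<le> E j) - (p(k := e)) j)
      \<le> s j * of_bool (x \<le> H j) * (of_bool (x \<le> E j) - (p(k := z)) j)"
      by (cases "j = k"; cases "x \<le> H j") auto
  qed
  with x show "\<exists>x. decides J E H x \<and> (\<exists>j\<in>J. x \<le> H j) \<and> 0 \<le> gain J E H (p(k := z)) s x"
    by (intro exI[of _ x]) auto
qed

section \<open>Verifiable families\<close>

definition verifiable :: "'i set \<Rightarrow> ('i \<Rightarrow> 'a::boolean_algebra) \<Rightarrow> ('i \<Rightarrow> 'a) \<Rightarrow> bool" where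
  "verifiable J E H \<longleftrightarrow>
     (\<exists>x. x \<noteq> bot \<and> (\<exists>j\<in>J. x \<le> H j) \<and> (\<forall>j\<in>J. inf x (H j) \<le> E j))"

text \<open>
  Buy every member of \<open>J\<close> with unit stake. A member that is not false yields at most the
  uncertainty \<open>1 - p j\<close>, and a false one loses \<open>p j\<close>, which is 1 less than that. If the
  uncertainties sum up to less than 1, an outcome without loss cannot falsify any member.
\<close>

lemma verifiable_if_sum_less_1:
  assumes fin: "finite I" and H: "\<forall>i\<in>I. H i \<noteq> bot" and coh: "coherent I E H p"
    and J: "J \<subseteq> I" "J \<noteq> {}" and sum: "(\<Sum>j\<in>J. 1 - p j) < 1"
  shows "verifiable J E H"
proof -
  have finJ: "finite J" using fin J finite_subset by blast
  obtain x where x: "decides J E H x" "\<exists>j\<in>J. x \<le> H j" "0 \<le> gain J E H p (\<lambda>_. 1) x"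
    using coh J coherent_iff[of I H E p, OF fin H] by meson
  have "x \<le> E i" if i: "i \<in> J" "x \<le> H i" for i
  proof (rule ccontr)
    assume false: "\<not> x \<le> E i"
    have "gain J E H p (\<lambda>_. 1) x \<le> (\<Sum>j\<in>J. (1 - p j) - of_bool (j = i))"
      unfolding gain_def
    proof (rule sum_mono)
      fix j assume "j \<in> J"
      then have "p j \<le> 1" using coherent_le_1[of I H E p j] fin H coh J by auto
      then show "1 * of_bool (x \<le> H j) * (of_bool (x \<le> E j) - p j)
        \<le> (1 - p j) - of_bool (j = i)"
        using false i by (cases "j = i") auto
    qed
    also have "\<dots> = (\<Sum>j\<in>J. 1 - p j) - 1"
      using finJ i(1) by (simp add: sum_subtractf of_bool_def)
    finally show False using x(3) sum by linarith
  qed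
  then have "inf x (H j) \<le> E j" if "j \<in> J" for j
    using that x(1) le_uminus_iff_not_le[of x "H j"]
    by (cases "x \<le> H j") (auto simp: decides_def intro: le_infI1 simp: inf_shunt[THEN iffD2])
  then show ?thesis using x(1,2) by (auto simp: verifiable_def decides_def)
qed

lemma coherent_one_iff:
  assumes fin: "finite I" and H: "\<forall>i\<in>I. H i \<noteq> bot"
  shows "coherent I E H (\<lambda>_. 1) \<longleftrightarrow> (\<forall>J. J \<subseteq> I \<and> J \<noteq> {} \<longrightarrow> verifiable J E H)"
proof
  assume "coherent I E H (\<lambda>_. 1)"
  then show "\<forall>J. J \<subseteq> I \<and> J \<noteq> {} \<longrightarrow> verifiable J E H"
    using verifiable_if_sum_less_1[of I H E "\<lambda>_. 1"] fin H by simp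
next
  assume ver: "\<forall>J. J \<subseteq> I \<and> J \<noteq> {} \<longrightarrow> verifiable J E H"
  show "coherent I E H (\<lambda>_. 1)"
    unfolding coherent_iff[of I H, OF fin H]
  proof (intro allI impI)
    fix J and s :: "'a \<Rightarrow> real" assume J: "J \<subseteq> I \<and> J \<noteq> {}"
    with ver have "verifiable J E H" by simp
    then obtain x where x: "x \<noteq> bot" "\<exists>j\<in>J. x \<le> H j" "\<forall>j\<in>J. inf x (H j) \<le> E j"
      unfolding verifiable_def by blast
    obtain y where y: "y \<le> x" "decides J E H y"
      using decides_below[of J x E H] finite_subset[of J I] fin J x(1) by blast
    have "y \<le> E j" if "j \<in> J" "y \<le> H j" for j
      using x(3) that y(1) by (meson le_infI order_trans)
    then have "gain J E H (\<lambda>_. 1) s y = 0"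
      unfolding gain_def by (intro sum.neutral) auto
    moreover have "\<exists>j\<in>J. y \<le> H j" using x(2) y(1) order_trans by blast
    ultimately show "\<exists>x. decides J E H x \<and> (\<exists>j\<in>J. x \<le> H j) \<and> 0 \<le> gain J E H (\<lambda>_. 1) s x"
      using y(2) by (intro exI[of _ y]) simp
  qed
qed

lemma coherent_zero_iff:
  assumes "finite I" "\<forall>i\<in>I. H i \<noteq> bot"
  shows "coherent I E H ((\<lambda>_. 1)(k := 0)) \<longleftrightarrow> coherent I (E(k := - E k)) H (\<lambda>_. 1)"
proof
  assume "coherent I E H ((\<lambda>_. 1)(k := 0))"
  from coherent_negate[OF assms this, of k]
  have "coherent I (E(k := - E k)) H ((\<lambda>_. 1)(k := 1))" by simp
  then show "coherent I (E(k := - E k)) H (\<lambda>_. 1)" by (simp only: fun_upd_idem)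
next
  assume "coherent I (E(k := - E k)) H (\<lambda>_. 1)"
  from coherent_negate[OF assms this, of k]
  show "coherent I E H ((\<lambda>_. 1)(k := 0))" by simp
qed

text \<open>
  Suppose that \<open>J\<close> is not verifiable and that \<open>K\<close> is not verifiable after the negation of \<open>E k\<close>;
  both must contain \<open>k\<close>. Take an event that verifies the members of \<open>J \<union> K\<close> other than \<open>k\<close>, or
  \<open>H k\<close> if there are none. If it excludes \<open>H k\<close>, then \<open>k\<close> is void under it, and it verifies that
  one of \<open>J\<close> and \<open>K\<close> which has the true member. If it meets \<open>H k\<close>, then its part in \<open>H k\<close> meets
  \<open>E k\<close>, and this verifies \<open>J\<close>, or \<open>- E k\<close>, and this verifies \<open>K\<close>.
\<close>

lemma coherent_one_extends:
  assumes fin: "finite I" and H: "\<forall>i\<in>insert k I. H i \<noteq> bot"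
    and coh: "coherent I E H (\<lambda>_. 1)"
  shows "coherent (insert k I) E H ((\<lambda>_. 1)(k := 0)) \<or> coherent (insert k I) E H (\<lambda>_. 1)"
proof (rule ccontr)
  let ?E = "E(k := - E k)"
  assume neg: "\<not> ?thesis"
  have finite': "finite (insert k I)" using fin by simp
  have ver: "\<And>M. M \<subseteq> I \<Longrightarrow> M \<noteq> {} \<Longrightarrow> verifiable M E H"
    using coh coherent_one_iff[of I H E] fin H by simp
  from neg obtain J where J: "J \<subseteq> insert k I" "J \<noteq> {}" "\<not> verifiable J E H"
    unfolding coherent_one_iff[of "insert k I" H E, OF finite' H] by blast
  from neg obtain K where K: "K \<subseteq> insert k I" "K \<noteq> {}" "\<not> verifiable K ?E H"
    unfolding coherent_zero_iff[of "insert k I" H E, OF finite' H]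
      coherent_one_iff[of "insert k I" H ?E, OF finite' H] by blast
  have kJ: "k \<in> J" using ver[of J] J by blast
  have "verifiable K ?E H = verifiable K E H" if "k \<notin> K"
    using that unfolding verifiable_def by (metis fun_upd_other)
  then have kK: "k \<in> K" using ver[of K] K by blast
  define M where "M = (J \<union> K) - {k}"
  have sub: "J \<subseteq> insert k M" "K \<subseteq> insert k M" by (auto simp: M_def)
  obtain x where x: "x \<noteq> bot" "\<exists>j\<in>insert k M. x \<le> H j" "\<forall>j\<in>M. inf x (H j) \<le> E j"
  proof (cases "M = {}")
    case True
    then show ?thesis using that[of "H k"] H by simp
  next
    case False
    moreover have "M \<subseteq> I" using J K by (auto simp: M_def)
    ultimately show ?thesis using ver[of M] that by (auto simp: verifiable_def)
  qed
  show False
  proof (cases "inf x (H k) = bot")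
    case True
    then have "j \<noteq> k" if "x \<le> H j" for j
      using that x(1) inf_absorb1[of x "H k"] by auto
    with x(2) obtain j where "j \<in> J \<union> K" "x \<le> H j" by (auto simp: M_def)
    moreover have "\<forall>j\<in>insert k M. inf x (H j) \<le> E j" "\<forall>j\<in>insert k M. inf x (H j) \<le> ?E j"
      using x(3) True by auto
    ultimately have "verifiable J E H \<or> verifiable K ?E H"
      using x(1) sub unfolding verifiable_def by blast
    then show False using J K by blast
  next
    case False
    define y where "y = inf x (H k)"
    have below: "inf v (H j) \<le> E j" if "v \<le> y" "j \<in> M" for v j
    proof -
      have "inf v (H j) \<le> inf x (H j)" using that(1) by (intro inf_mono) (auto simp: y_def)
      then show ?thesis using x(3) that(2) order_trans by blast
    qed
    have yH: "y \<le> H k" by (simp add: y_def)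
    have "y = sup (inf y (E k)) (inf y (- E k))"
      by (simp flip: inf_sup_distrib1)
    then consider "inf y (E k) \<noteq> bot" | "inf y (- E k) \<noteq> bot"
      using False by (fastforce simp: y_def)
    then show False
    proof cases
      case 1
      have "inf (inf y (E k)) (H j) \<le> E j" if "j \<in> J" for j
        using below[of "inf y (E k)" j] sub(1) that by (cases "j = k") (auto intro: le_infI1)
      then have "verifiable J E H"
        unfolding verifiable_def using 1 kJ yH by (intro exI[of _ "inf y (E k)"]) (auto intro: le_infI1)
      then show False using J by blast
    next
      case 2
      have "inf (inf y (- E k)) (H j) \<le> ?E j" if "j \<in> K" for j
        using below[of "inf y (- E k)" j] sub(2) that by (cases "j = k") (auto intro: le_infI1)
      then have "verifiable K ?E H"
        unfolding verifiable_def using 2 kK yH by (intro exI[of _ "inf y (- E k)"]) (auto intro: le_infI1)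
      then show False using K by blast
    qed
  qed
qed

section \<open>p-consistency and p-entailment\<close>

lemma p_consistent_iff:
  assumes fin: "finite I" and H: "\<forall>i\<in>I. H i \<noteq> bot"
  shows "p_consistent I E H \<longleftrightarrow> coherent I E H (\<lambda>_. 1)"
proof
  assume cons: "p_consistent I E H"
  show "coherent I E H (\<lambda>_. 1)"
    unfolding coherent_one_iff[of I H, OF fin H]
  proof (intro allI impI)
    fix J assume J: "J \<subseteq> I \<and> J \<noteq> {}"
    \<comment> \<open>Any uncertainty below \<open>1 / card J\<close> keeps the sum over \<open>J\<close> below 1.\<close>
    define d where "d = 1 / (real (card J) + 1)"
    have "1 - d \<in> {0..<1}" by (auto simp: d_def)
    then obtain p where p: "coherent I E H p" "\<forall>i\<in>I. 1 - d \<le> p i"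
      using cons[unfolded p_consistent_def, rule_format, of "\<lambda>_. 1 - d"] by blast
    have "(\<Sum>j\<in>J. 1 - p j) \<le> (\<Sum>j\<in>J. d)"
      using p(2) J by (intro sum_mono) (auto simp: algebra_simps)
    also have "\<dots> < 1" by (simp add: d_def field_simps)
    finally show "verifiable J E H"
      using verifiable_if_sum_less_1[of I H E p J] fin H p(1) J by blast
  qed
next
  assume "coherent I E H (\<lambda>_. 1)"
  then show "p_consistent I E H"
    unfolding p_consistent_def by (intro allI impI exI[of _ "\<lambda>_. 1"]) (auto simp: less_imp_le)
qed

text \<open>
  If \<open>(1, \<dots>, 1, 0)\<close> is coherent, it refutes entailment, since it meets every bound on the
  premises. Otherwise some subfamily of the premises together with \<open>- B | A\<close> is not verifiable, so
  that the uncertainties of the premises and the uncertainty \<open>z\<close> of \<open>- B | A\<close> sum up to at least 1.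
  Premises with uncertainties of at most \<open>(1 - \<alpha>) / n\<close> then leave no room for \<open>z\<close> below \<open>\<alpha>\<close>.
\<close>

lemma p_entails_iff:
  assumes n: "n \<ge> 1" and H: "\<And>i. i \<in> {1..n} \<Longrightarrow> H i \<noteq> bot" and A: "A \<noteq> bot"
  shows "p_entails n E H B A \<longleftrightarrow>
    \<not> coherent {1..Suc n} (E(Suc n := B)) (H(Suc n := A)) ((\<lambda>_. 1)(Suc n := 0))"
proof -
  let ?k = "Suc n" and ?I = "{1..Suc n}"
  let ?E = "E(?k := B)" and ?E' = "E(?k := - B)" and ?H = "H(?k := A)"
  have I: "?I = insert ?k {1..n}" by auto
  have H': "\<forall>i\<in>?I. ?H i \<noteq> bot"
    using H A by auto
  have fin: "finite ?I" by simp
  show ?thesis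
  proof
    assume ent: "p_entails n E H B A"
    then obtain J where "J \<subseteq> {1..n}" and "\<And>\<alpha>::real. \<alpha> \<in> {0..<1} \<Longrightarrow>
      \<exists>a::nat \<Rightarrow> real. (\<forall>i\<in>J. a i \<in> {0..<1}) \<and>
        (\<forall>p z. coherent (insert ?k J) ?E ?H (p(?k := z)) \<longrightarrow> (\<forall>i\<in>J. a i \<le> p i) \<longrightarrow> \<alpha> \<le> z)"
      unfolding p_entails_def by blast
    \<comment> \<open>Any positive level \<open>\<alpha>\<close> contradicts \<open>z = 0\<close>.\<close>
    from this(1) this(2)[of "1/2"] obtain a :: "nat \<Rightarrow> real" where
      J: "J \<subseteq> {1..n}" and a: "\<forall>i\<in>J. a i \<in> {0..<1}" and
      bound: "\<And>p z. coherent (insert ?k J) ?E ?H (p(?k := z)) \<Longrightarrow> \<forall>i\<in>J. a i \<le> p i \<Longrightarrow> 1/2 \<le> z"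
      by auto
    show "\<not> coherent ?I ?E ?H ((\<lambda>_. 1)(?k := 0))"
    proof
      assume "coherent ?I ?E ?H ((\<lambda>_. 1)(?k := 0))"
      then have "coherent (insert ?k J) ?E ?H ((\<lambda>_. 1)(?k := 0))"
        using J by (auto elim!: coherent_subset)
      from bound[OF this] a show False by (auto simp: less_imp_le)
    qed
  next
    assume "\<not> coherent ?I ?E ?H ((\<lambda>_. 1)(?k := 0))"
    then have "\<not> coherent ?I ?E' ?H (\<lambda>_. 1)"
      using coherent_zero_iff[of ?I ?H ?E ?k, OF fin H'] by simp
    then obtain L where L: "L \<subseteq> ?I" "L \<noteq> {}" "\<not> verifiable L ?E' ?H"
      using coherent_one_iff[of ?I ?H ?E', OF fin H'] by blast
    show "p_entails n E H B A"
      unfolding p_entails_def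
    proof (intro exI[of _ "{1..n}"] conjI allI impI)
      show "{1..n} \<noteq> {}" using n by simp
      fix \<alpha> :: real assume \<alpha>: "\<alpha> \<in> {0..<1}"
      have "(1 - \<alpha>) / n \<le> (1 - \<alpha>) / 1" using \<alpha> n by (intro divide_left_mono) auto
      then have range: "1 - (1 - \<alpha>) / n \<in> {0..<1}" using \<alpha> n by auto
      show "\<exists>a::nat \<Rightarrow> real. (\<forall>i\<in>{1..n}. a i \<in> {0..<1}) \<and>
        (\<forall>p z. coherent (insert ?k {1..n}) ?E ?H (p(?k := z)) \<longrightarrow>
          (\<forall>i\<in>{1..n}. a i \<le> p i) \<longrightarrow> \<alpha> \<le> z)"
      proof (intro exI[of _ "\<lambda>_. 1 - (1 - \<alpha>) / n"] conjI allI impI ballI range)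
        fix p :: "nat \<Rightarrow> real" and z
        assume coh: "coherent (insert ?k {1..n}) ?E ?H (p(?k := z))"
          and p: "\<forall>i\<in>{1..n}. 1 - (1 - \<alpha>) / n \<le> p i"
        let ?p = "p(?k := 1 - z)"
        have coh': "coherent ?I ?E' ?H ?p"
          using coherent_negate[of ?I ?H ?E "p(?k := z)" ?k, OF fin H'] coh
          unfolding I by simp
        have "1 \<le> (\<Sum>i\<in>L. 1 - ?p i)"
          using verifiable_if_sum_less_1[of ?I ?H ?E' ?p L, OF fin H' coh'] L by fastforce
        also have "\<dots> \<le> (\<Sum>i\<in>?I. 1 - ?p i)"
          using coherent_le_1[of ?I ?H ?E' ?p, OF fin H' coh'] L(1)
          by (intro sum_mono2) (auto simp del: fun_upd_apply)
        also have "\<dots> = (\<Sum>i\<in>{1..n}. 1 - p i) + z"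
          unfolding I by simp
        also have "\<dots> \<le> (\<Sum>i\<in>{1..n}. (1 - \<alpha>) / n) + z"
          using p by (intro add_right_mono sum_mono) (auto simp: algebra_simps)
        also have "\<dots> = 1 - \<alpha> + z" using n by simp
        finally show "\<alpha> \<le> z" by simp
      qed
    qed simp
  qed
qed

theorem theorem7:
  fixes Es Hs :: "nat \<Rightarrow> 'a::boolean_algebra" and E H :: 'a and n :: nat
  assumes "n \<ge> 1"
    and "\<And>i. i \<in> {1..n} \<Longrightarrow> Hs i \<noteq> bot"
    and "H \<noteq> bot"
    and "p_consistent {1..n} Es Hs"
  shows "p_consistent {1..Suc n} (Es(Suc n := E)) (Hs(Suc n := H)) \<longleftrightarrow>
    (let entailed = p_entails n Es Hs E H;
         all_coherent = (\<forall>z\<in>{0..1}.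
           coherent {1..Suc n} (Es(Suc n := E)) (Hs(Suc n := H)) ((\<lambda>i. 1)(Suc n := z)))
     in (entailed \<or> all_coherent) \<and> \<not> (entailed \<and> all_coherent))"
proof -
  let ?I = "{1..Suc n}" and ?E = "Es(Suc n := E)" and ?H = "Hs(Suc n := H)"
  define C where "C z = coherent ?I ?E ?H ((\<lambda>_. 1)(Suc n := z))" for z
  have I: "?I = insert (Suc n) {1..n}" by auto
  have H: "\<forall>i\<in>?I. ?H i \<noteq> bot"
    using assms(2,3) by auto
  have one: "(\<lambda>_. 1)(Suc n := 1) = (\<lambda>_. 1 :: real)" by auto
  have "coherent {1..n} Es Hs (\<lambda>_. 1)"
    using assms(4) by (subst (asm) p_consistent_iff) (use assms(2) in auto)
  then have base: "coherent {1..n} ?E ?H (\<lambda>_. 1)"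
    using coherent_cong[of "{1..n}" ?E Es ?H Hs "\<lambda>_. 1" "\<lambda>_. 1"] by simp
  have extends: "C 0 \<or> C 1"
    unfolding C_def one I using base H[unfolded I] by (intro coherent_one_extends) simp_all
  have between: "C z" if "C 0" "C 1" "z \<in> {0..1}" for z
    using that coherent_between[of ?I ?H ?E "\<lambda>_. 1" "Suc n" 0 1 z] H by (simp add: C_def)
  have consistent: "p_consistent ?I ?E ?H \<longleftrightarrow> C 1"
    unfolding C_def one using H by (intro p_consistent_iff) auto
  have entails: "p_entails n Es Hs E H \<longleftrightarrow> \<not> C 0"
    unfolding C_def using assms by (intro p_entails_iff)
  have "(\<forall>z\<in>{0..1}. C z) \<longleftrightarrow> C 0 \<and> C 1" using between by auto
  then show ?thesis
    unfolding consistent entails C_def[symmetric] Let_def using extends by blast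
qed

end
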